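(* Let $S_{\boldsymbol\lambda}$ be a densely defined weighted shift on a directed tree $\mathcal T=(V,E)$ with weights $\boldsymbol\lambda=\{\lambda_v\}_{v\in V^\circ}$. Put $V^+_{\boldsymbol\lambda}=\{u\in V:\|S_{\boldsymbol\lambda}e_u\|>0\}$ and $$\mathfrak b(S_{\boldsymbol\lambda})=\sum_{u\in V^+_{\boldsymbol\lambda}}(\operatorname{card}(\operatorname{Chi}(u))-1)+\sum_{u\in V'\setminus V^+_{\boldsymbol\lambda}}\operatorname{card}(\operatorname{Chi}(u)),$$ $$\mathfrak c(S_{\boldsymbol\lambda})=\inf\{|\lambda_u|:u\in V^\circ,\ \lambda_u\neq0,\ \operatorname{card}(\operatorname{Chi}(\operatorname{par}(u)))=1\}$$ (with $\inf\varnothing=\infty$). Then the following conditions are equivalent: (i) $S_{\boldsymbol\lambda}$ is a Fredholm operator; (ii) $\mathfrak c(S_{\boldsymbol\lambda})>0$ and $\mathfrak b(S_{\boldsymbol\lambda})<\infty$; (iii) $\mathfrak c(S_{\boldsymbol\lambda})>0$, $\operatorname{card}(\operatorname{Chi}(u))<\infty$ for all $u\in V$, $\operatorname{card}(V_\prec)<\infty$ and $\operatorname{card}(V'\setminus V^+_{\boldsymbol\lambda})<\infty$, where $V_\prec=\{u\in V:\operatorname{card}(\operatorname{Chi}(u))\ge2\}$. If $S_{\boldsymbol\lambda}$ is Fredholm, then $\mathfrak a(S_{\boldsymbol\lambda}):=\operatorname{card}(V\setminus V^+_{\boldsymbol\lambda})<\infty$ and $$\operatorname{ind}(S_{\boldsymbol\lambda})=\begin{cases}\mathfrak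 a(S_{\boldsymbol\lambda})-\mathfrak b(S_{\boldsymbol\lambda})-1&\text{if }\mathcal T\text{ has a root},\\ \mathfrak a(S_{\boldsymbol\lambda})-\mathfrak b(S_{\boldsymbol\lambda})&\text{otherwise}.\end{cases}$$
   Context: A directed tree $\mathcal T=(V,E)$ consists of a nonempty set $V$ (of arbitrary cardinality) of vertices and a set $E\subseteq V\times V\setminus\{(v,v):v\in V\}$ of edges such that: (1) any two distinct vertices $u,v$ are joined by an undirected path, i.e. there are $v_1=u,\dots,v_n=v$ in $V$ ($n\ge 2$) with $(v_j,v_{j+1})\in E$ or $(v_{j+1},v_j)\in E$ for each $j<n$; (2) there is no circuit, i.e. no finite sequence of distinct vertices $u_1,\dots,u_n$ ($n\ge2$) with $(u_j,u_{j+1})\in E$ for $j<n$ and $(u_n,u_1)\in E$; (3) every vertex $v$ that is not a root has a unique vertex $\operatorname{par}(v)$ (its parent) with $(\operatorname{par}(v),v)\in E$; a root is a vertex $v$ for which there is no $u$ with $(u,v)\in E$. A directed tree has at most one root, denoted $\mathrm{root}$ when it exists. $V^\circ$ is $V$ with the root removed (and $V^\circ=V$ if $\mathcal T$ has no root). $\operatorname{Chi}(u)=\{v\in V:(u,v)\in E\}$, and $V'=\{u\in V:\operatorname{Chi}(u)\ne\varnothing\}$. $\ell^2(V)$ is the Hilbert space of square summable complex functions on $V$, with orthonormal basis $\{e_u\}_{u\in V}$, $e_u$ being the indicator function of $\{u\}$. For $\boldsymbol\lambda=\{\lambda_v\}_{v\in V^\circ}\subseteq\mathbb C$ and $f\colon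 V\to\mathbb C$ put $(\Lambda f)(v)=\lambda_v f(\operatorname{par}(v))$ for $v\in V^\circ$ and $(\Lambda f)(\mathrm{root})=0$. The weighted shift $S_{\boldsymbol\lambda}$ is the operator in $\ell^2(V)$ with domain $\{f\in\ell^2(V):\Lambda f\in\ell^2(V)\}$ and $S_{\boldsymbol\lambda}f=\Lambda f$. It is closed, and densely defined if and only if every $e_u$ lies in its domain, in which case $\|S_{\boldsymbol\lambda}e_u\|^2=\sum_{v\in\operatorname{Chi}(u)}|\lambda_v|^2<\infty$ (sum over the empty set is $0$). A closed densely defined operator $T$ in a complex Hilbert space is Fredholm if its range is closed and the kernels $\mathcal N(T)$ and $\mathcal N(T^* )$ are finite dimensional; its index is $\operatorname{ind}(T)=\dim\mathcal N(T)-\dim\mathcal N(T^* )$. *)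

theory Defs
  imports "HOL-Analysis.Analysis" "HOL-Library.Function_Algebras"
begin

section \<open>Directed trees\<close>

definition is_root :: "'a set \<Rightarrow> ('a \<times> 'a) set \<Rightarrow> 'a \<Rightarrow> bool" where
  "is_root V E v \<longleftrightarrow> v \<in> V \<and> (\<nexists>u. (u, v) \<in> E)"

locale directed_tree =
  fixes V :: "'a set" and E :: "('a \<times> 'a) set"
  assumes nonempty: "V \<noteq> {}"
    and edges: "E \<subseteq> V \<times> V - {(v, v) |v. v \<in> V}"
    and connected: "\<And>u v. u \<in> V \<Longrightarrow> v \<in> V \<Longrightarrow> u \<noteq> v \<Longrightarrow>
      \<exists>p. 2 \<le> length p \<and> set p \<subseteq> V \<and> hd p = u \<and> last p = v \<and>
        (\<forall>j. Suc j < length p \<longrightarrow> (p ! j, p ! Suc j) \<in> E \<or> (p ! Suc j, p ! j) \<in> E)"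
    and no_circuit: "\<nexists>p. 2 \<le> length p \<and> distinct p \<and> set p \<subseteq> V \<and>
        (\<forall>j. Suc j < length p \<longrightarrow> (p ! j, p ! Suc j) \<in> E) \<and> (last p, hd p) \<in> E"
    and unique_parent: "\<And>v. v \<in> V \<Longrightarrow> \<not> is_root V E v \<Longrightarrow> \<exists>!u. (u, v) \<in> E"

definition has_root :: "'a set \<Rightarrow> ('a \<times> 'a) set \<Rightarrow> bool" where
  "has_root V E \<longleftrightarrow> (\<exists>v. is_root V E v)"

definition non_roots :: "'a set \<Rightarrow> ('a \<times> 'a) set \<Rightarrow> 'a set" where
  "non_roots V E = {v \<in> V. \<not> is_root V E v}"

definition par :: "('a \<times> 'a) set \<Rightarrow> 'a \<Rightarrow> 'a" where
  "par E v = (THE u. (u, v) \<in> E)"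

definition children :: "'a set \<Rightarrow> ('a \<times> 'a) set \<Rightarrow> 'a \<Rightarrow> 'a set" where
  "children V E u = {v \<in> V. (u, v) \<in> E}"

definition non_leaves :: "'a set \<Rightarrow> ('a \<times> 'a) set \<Rightarrow> 'a set" where
  "non_leaves V E = {u \<in> V. children V E u \<noteq> {}}"

text \<open>Trees need not be locally finite, and \<^const>\<open>card\<close> sends infinite sets to 0.  All infinite
  cardinals are identified with \<open>\<infinity>\<close>.\<close>

definition ecard :: "'a set \<Rightarrow> enat" where
  "ecard A = (if finite A then enat (card A) else \<infinity>)"

definition branching :: "'a set \<Rightarrow> ('a \<times> 'a) set \<Rightarrow> 'a set" where
  "branching V E = {u \<in> V. 2 \<le> ecard (children V E u)}"


section \<open>The Hilbert space of square summable functions\<close>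

text \<open>Functions on \<open>V\<close> are functions on the whole type vanishing outside \<open>V\<close>.\<close>

definition ell2 :: "'a set \<Rightarrow> ('a \<Rightarrow> complex) set" where
  "ell2 V = {f. (\<forall>v. v \<notin> V \<longrightarrow> f v = 0) \<and> (\<lambda>v. (cmod (f v))\<^sup>2) summable_on V}"

definition ell2_inner :: "'a set \<Rightarrow> ('a \<Rightarrow> complex) \<Rightarrow> ('a \<Rightarrow> complex) \<Rightarrow> complex" where
  "ell2_inner V f g = (\<Sum>\<^sub>\<infinity>v\<in>V. f v * cnj (g v))"

definition ell2_norm :: "'a set \<Rightarrow> ('a \<Rightarrow> complex) \<Rightarrow> real" where
  "ell2_norm V f = sqrt (\<Sum>\<^sub>\<infinity>v\<in>V. (cmod (f v))\<^sup>2)"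

definition ell2_dist :: "'a set \<Rightarrow> ('a \<Rightarrow> complex) \<Rightarrow> ('a \<Rightarrow> complex) \<Rightarrow> real" where
  "ell2_dist V f g = ell2_norm V (f - g)"

lemma ell2_diff:
  assumes "f \<in> ell2 V" "g \<in> ell2 V"
  shows "f - g \<in> ell2 V"
proof -
  have s: "(\<lambda>v. 2 * (cmod (f v))\<^sup>2 + 2 * (cmod (g v))\<^sup>2) summable_on V"
    using assms by (intro summable_on_add summable_on_cmult_right) (auto simp: ell2_def)
  have "(cmod (f v - g v))\<^sup>2 \<le> 2 * (cmod (f v))\<^sup>2 + 2 * (cmod (g v))\<^sup>2" for v
  proof -
    have "(cmod (f v - g v))\<^sup>2 \<le> (cmod (f v) + cmod (g v))\<^sup>2"
      by (intro power_mono norm_triangle_ineq4) auto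
    also have "\<dots> \<le> 2 * (cmod (f v))\<^sup>2 + 2 * (cmod (g v))\<^sup>2"
      using sum_squares_bound[of "cmod (f v)" "cmod (g v)"] by (simp add: power2_sum)
    finally show ?thesis .
  qed
  then have "(\<lambda>v. (cmod (f v - g v))\<^sup>2) summable_on V"
    by (intro summable_on_comparison_test[OF s]) auto
  then show ?thesis using assms by (auto simp: ell2_def)
qed

lemma L2_set_le_ell2_norm:
  assumes "f \<in> ell2 V" "finite F" "F \<subseteq> V"
  shows "L2_set (\<lambda>v. cmod (f v)) F \<le> ell2_norm V f"
  unfolding L2_set_def ell2_norm_def
  using assms by (intro real_sqrt_le_mono finite_sum_le_infsum) (auto simp: ell2_def)

lemma ell2_norm_leI:
  assumes "f \<in> ell2 V" "0 \<le> B"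
    and "\<And>F. finite F \<Longrightarrow> F \<subseteq> V \<Longrightarrow> L2_set (\<lambda>v. cmod (f v)) F \<le> B"
  shows "ell2_norm V f \<le> B"
proof -
  have "(\<Sum>\<^sub>\<infinity>v\<in>V. (cmod (f v))\<^sup>2) \<le> B\<^sup>2"
  proof (rule infsum_le_finite_sums)
    show "(\<lambda>v. (cmod (f v))\<^sup>2) summable_on V" using assms(1) by (auto simp: ell2_def)
    fix F assume "finite F" "F \<subseteq> V"
    from assms(3)[OF this] have "sqrt (\<Sum>v\<in>F. (cmod (f v))\<^sup>2) \<le> B" by (simp add: L2_set_def)
    then show "(\<Sum>v\<in>F. (cmod (f v))\<^sup>2) \<le> B\<^sup>2" by (rule sqrt_le_D)
  qed
  then show ?thesis unfolding ell2_norm_def using assms(2) by (rule real_le_lsqrt[rotated])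
qed

lemma Metric_space_ell2: "Metric_space (ell2 V) (ell2_dist V)"
proof
  fix f g h :: "'a \<Rightarrow> complex"
  show "0 \<le> ell2_dist V f g"
    by (auto simp: ell2_dist_def ell2_norm_def intro!: infsum_nonneg)
  show "ell2_dist V f g = ell2_dist V g f"
    by (simp add: ell2_dist_def ell2_norm_def norm_minus_commute)
  assume f: "f \<in> ell2 V" and g: "g \<in> ell2 V"
  show "ell2_dist V f g = 0 \<longleftrightarrow> f = g"
  proof
    assume "ell2_dist V f g = 0"
    then have "(\<Sum>\<^sub>\<infinity>v\<in>V. (cmod ((f - g) v))\<^sup>2) = 0"
      by (simp add: ell2_dist_def ell2_norm_def)
    then have "(cmod ((f - g) v))\<^sup>2 = 0" if "v \<in> V" for v
      using ell2_diff[OF f g] that by (intro nonneg_infsum_le_0D[of _ V]) (auto simp: ell2_def)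
    then show "f = g" using f g by (fastforce simp: ell2_def)
  qed (simp add: ell2_dist_def ell2_norm_def)
  assume h: "h \<in> ell2 V"
  have nn: "0 \<le> ell2_norm V k" for k
    by (auto simp: ell2_norm_def intro!: infsum_nonneg)
  show "ell2_dist V f h \<le> ell2_dist V f g + ell2_dist V g h"
    unfolding ell2_dist_def
  proof (rule ell2_norm_leI[OF ell2_diff[OF f h]])
    fix F assume F: "finite F" "F \<subseteq> V"
    have "L2_set (\<lambda>v. cmod ((f - h) v)) F \<le>
        L2_set (\<lambda>v. cmod ((f - g) v) + cmod ((g - h) v)) F"
      by (intro L2_set_mono) (auto intro: norm_diff_triangle_le)
    also have "\<dots> \<le> L2_set (\<lambda>v. cmod ((f - g) v)) F + L2_set (\<lambda>v. cmod ((g - h) v)) F"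
      by (rule L2_set_triangle_ineq)
    also have "\<dots> \<le> ell2_norm V (f - g) + ell2_norm V (g - h)"
      using F f g h by (intro add_mono L2_set_le_ell2_norm ell2_diff)
    finally show "L2_set (\<lambda>v. cmod ((f - h) v)) F \<le> \<dots>" .
  qed (simp add: nn)
qed

definition ell2_topology :: "'a set \<Rightarrow> ('a \<Rightarrow> complex) topology" where
  "ell2_topology V = Metric_space.mtopology (ell2 V) (ell2_dist V)"

definition cscale :: "complex \<Rightarrow> ('a \<Rightarrow> complex) \<Rightarrow> 'a \<Rightarrow> complex" where
  "cscale c f = (\<lambda>v. c * f v)"

interpretation cfun: vector_space cscale
  by unfold_locales (auto simp: cscale_def algebra_simps)

definition finite_dimensional :: "('a \<Rightarrow> complex) set \<Rightarrow> bool" where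
  "finite_dimensional N \<longleftrightarrow> (\<exists>B. finite B \<and> B \<subseteq> N \<and> N \<subseteq> cfun.span B)"


section \<open>Unbounded operators\<close>

text \<open>An operator in \<^term>\<open>ell2 V\<close> is identified with its graph, so \<^const>\<open>Domain\<close> and
  \<^const>\<open>Range\<close> are its domain and range.\<close>

definition linear_operator :: "'a set \<Rightarrow> (('a \<Rightarrow> complex) \<times> ('a \<Rightarrow> complex)) set \<Rightarrow> bool" where
  "linear_operator V T \<longleftrightarrow> T \<subseteq> ell2 V \<times> ell2 V \<and> single_valued T \<and> (0, 0) \<in> T \<and>
     (\<forall>f g f' g'. (f, g) \<in> T \<longrightarrow> (f', g') \<in> T \<longrightarrow> (f + f', g + g') \<in> T) \<and>
     (\<forall>c f g. (f, g) \<in> T \<longrightarrow> (cscale c f, cscale c g) \<in> T)"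

definition densely_defined :: "'a set \<Rightarrow> (('a \<Rightarrow> complex) \<times> ('a \<Rightarrow> complex)) set \<Rightarrow> bool" where
  "densely_defined V T \<longleftrightarrow> ell2_topology V closure_of Domain T = ell2 V"

definition closed_operator :: "'a set \<Rightarrow> (('a \<Rightarrow> complex) \<times> ('a \<Rightarrow> complex)) set \<Rightarrow> bool" where
  "closed_operator V T \<longleftrightarrow>
     linear_operator V T \<and> closedin (prod_topology (ell2_topology V) (ell2_topology V)) T"

definition adjoint_op ::
  "'a set \<Rightarrow> (('a \<Rightarrow> complex) \<times> ('a \<Rightarrow> complex)) set \<Rightarrow> (('a \<Rightarrow> complex) \<times> ('a \<Rightarrow> complex)) set" where
  "adjoint_op V T = {(g, h). g \<in> ell2 V \<and> h \<in> ell2 V \<and>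
     (\<forall>(f, k) \<in> T. ell2_inner V k g = ell2_inner V f h)}"

definition null_space :: "(('a \<Rightarrow> complex) \<times> ('a \<Rightarrow> complex)) set \<Rightarrow> ('a \<Rightarrow> complex) set" where
  "null_space T = {f. (f, 0) \<in> T}"

definition fredholm :: "'a set \<Rightarrow> (('a \<Rightarrow> complex) \<times> ('a \<Rightarrow> complex)) set \<Rightarrow> bool" where
  "fredholm V T \<longleftrightarrow> closed_operator V T \<and> densely_defined V T \<and>
     closedin (ell2_topology V) (Range T) \<and>
     finite_dimensional (null_space T) \<and> finite_dimensional (null_space (adjoint_op V T))"

definition fredholm_index :: "'a set \<Rightarrow> (('a \<Rightarrow> complex) \<times> ('a \<Rightarrow> complex)) set \<Rightarrow> int" where
  "fredholm_index V T =
     int (cfun.dim (null_space T)) - int (cfun.dim (null_space (adjoint_op V T)))"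


section \<open>Weighted shifts\<close>

text \<open>Only the values of \<open>lam\<close> on \<^term>\<open>non_roots V E\<close> matter.\<close>

definition shift_map ::
  "'a set \<Rightarrow> ('a \<times> 'a) set \<Rightarrow> ('a \<Rightarrow> complex) \<Rightarrow> ('a \<Rightarrow> complex) \<Rightarrow> 'a \<Rightarrow> complex" where
  "shift_map V E lam f = (\<lambda>v. if v \<in> non_roots V E then lam v * f (par E v) else 0)"

definition weighted_shift ::
  "'a set \<Rightarrow> ('a \<times> 'a) set \<Rightarrow> ('a \<Rightarrow> complex) \<Rightarrow> (('a \<Rightarrow> complex) \<times> ('a \<Rightarrow> complex)) set" where
  "weighted_shift V E lam =
     {(f, shift_map V E lam f) |f. f \<in> ell2 V \<and> shift_map V E lam f \<in> ell2 V}"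

text \<open>The indicator function of \<open>{u}\<close> is the basis vector at \<open>u\<close>; it lies in the domain of every
  densely defined weighted shift, and there the shift acts as \<^const>\<open>shift_map\<close>.\<close>

definition V_plus :: "'a set \<Rightarrow> ('a \<times> 'a) set \<Rightarrow> ('a \<Rightarrow> complex) \<Rightarrow> 'a set" where
  "V_plus V E lam = {u \<in> V. 0 < ell2_norm V (shift_map V E lam (indicator {u}))}"

definition shift_a :: "'a set \<Rightarrow> ('a \<times> 'a) set \<Rightarrow> ('a \<Rightarrow> complex) \<Rightarrow> enat" where
  "shift_a V E lam = ecard (V - V_plus V E lam)"

definition shift_b :: "'a set \<Rightarrow> ('a \<times> 'a) set \<Rightarrow> ('a \<Rightarrow> complex) \<Rightarrow> enat" where
  "shift_b V E lam =
     (\<Sum>\<^sub>\<infinity>u\<in>V_plus V E lam. ecard (children V E u) - 1) +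
     (\<Sum>\<^sub>\<infinity>u\<in>non_leaves V E - V_plus V E lam. ecard (children V E u))"

definition shift_c :: "'a set \<Rightarrow> ('a \<times> 'a) set \<Rightarrow> ('a \<Rightarrow> complex) \<Rightarrow> ereal" where
  "shift_c V E lam =
     Inf {ereal (cmod (lam u)) |u.
            u \<in> non_roots V E \<and> lam u \<noteq> 0 \<and> ecard (children V E (par E u)) = 1}"

end

theory Submission
  imports Defs
begin

text \<open>The shift maps the basis vector at \<open>u\<close> to a vector supported on the children of \<open>u\<close>, so it
  is an orthogonal sum of rank one maps.  Its kernel consists of the functions vanishing on
  \<^term>\<open>V_plus V E lam\<close>.  A function is in the kernel of the adjoint iff it is orthogonal to the image
  of every basis vector; for \<open>u\<close> in \<^term>\<open>V_plus V E lam\<close> this linear equation determines the value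
  at one child of \<open>u\<close> with nonzero weight, the pivot of \<open>u\<close>, from the values at its siblings.  The
  vertices that are not pivots are therefore free coordinates on this kernel, and their number is
  \<^term>\<open>shift_b V E lam\<close>, plus one for the root.  The range is closed iff the norms of the nonzero
  images of basis vectors are bounded away from 0; once branching is finite this concerns only
  vertices with a single child.\<close>

section \<open>Extended cardinality and square summable functions\<close>

lemma sum_fun_apply: "(\<Sum>i\<in>A. f i) x = (\<Sum>i\<in>A. f i x)"
  for f :: "'i \<Rightarrow> 'b \<Rightarrow> 'c :: comm_monoid_add"
  by (induction A rule: infinite_finite_induct) auto

text \<open>The \<open>h w\<close> form a basis dual to the evaluations at points of
  \<open>I\<close>. Evaluation at \<open>w\<close> kills every other \<open>h w'\<close>, which
  gives independence; for finite \<open>I\<close>, subtracting the combination with coefficients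
  \<open>f w\<close> leaves a member of \<open>N\<close> vanishing on \<open>I\<close>. Both kernels
  are measured this way.\<close>

lemma finite_dimensional_coordinates:
  assumes N: "cfun.subspace N"
    and h: "\<And>w. w \<in> I \<Longrightarrow> h w \<in> N"
    and delta: "\<And>w w'. w \<in> I \<Longrightarrow> w' \<in> I \<Longrightarrow> h w w' = (if w = w' then 1 else 0)"
    and zero: "\<And>f. f \<in> N \<Longrightarrow> (\<And>w. w \<in> I \<Longrightarrow> f w = 0) \<Longrightarrow> f = 0"
  shows "finite_dimensional N \<longleftrightarrow> finite I"
    and "finite I \<Longrightarrow> cfun.dim N = card I"
proof -
  have inj: "inj_on h I"
    using delta by (auto simp: inj_on_def) (metis zero_neq_one)
  have indep: "cfun.independent (h ` I)"
  proof
    assume "cfun.dependent (h ` I)"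
    then obtain w where w: "w \<in> I" "h w \<in> cfun.span (h ` I - {h w})"
      by (auto simp: cfun.dependent_def)
    have "cfun.subspace {f. f w = 0}"
      by (auto simp: cfun.subspace_def cscale_def)
    moreover have "h ` I - {h w} \<subseteq> {f. f w = 0}"
      using w(1) delta by auto
    ultimately have "h w \<in> {f. f w = 0}"
      using w(2) cfun.span_minimal by blast
    with delta[OF w(1) w(1)] show False by simp
  qed
  have spans: "N \<subseteq> cfun.span (h ` I)" if "finite I"
  proof
    fix f assume f: "f \<in> N"
    let ?s = "\<Sum>w\<in>I. cscale (f w) (h w)"
    have s: "?s \<in> N"
      using N h by (intro cfun.subspace_sum cfun.subspace_scale)
    have "f - ?s = 0"
    proof (rule zero)
      show "f - ?s \<in> N" using N f s by (rule cfun.subspace_diff)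
      fix w assume w: "w \<in> I"
      have "?s w = (\<Sum>w'\<in>I. if w' = w then f w' else 0)"
        unfolding sum_fun_apply cscale_def using delta w by (intro sum.cong) auto
      then show "(f - ?s) w = 0" using that w by simp
    qed
    then have "f = ?s" by simp
    moreover have "?s \<in> cfun.span (h ` I)"
      by (intro cfun.span_sum cfun.span_scale cfun.span_base) auto
    ultimately show "f \<in> cfun.span (h ` I)" by simp
  qed
  show "finite_dimensional N \<longleftrightarrow> finite I"
  proof
    assume "finite_dimensional N"
    then obtain B where "finite B" "N \<subseteq> cfun.span B" by (auto simp: finite_dimensional_def)
    moreover have "h ` I \<subseteq> N" using h by auto
    ultimately have "finite (h ` I)"
      using cfun.independent_span_bound[OF _ indep] by blast
    then show "finite I" using inj by (rule finite_imageD)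
  next
    assume "finite I"
    with spans h show "finite_dimensional N"
      unfolding finite_dimensional_def by (intro exI[of _ "h ` I"]) auto
  qed
  show "cfun.dim N = card I" if "finite I"
  proof -
    have "h ` I \<subseteq> N" using h by auto
    from cfun.basis_card_eq_dim[OF this spans[OF that] indep] show ?thesis
      by (simp add: card_image[OF inj])
  qed
qed

section \<open>Cardinalities of disjoint unions as sums in \<open>enat\<close>\<close>

lemma ecard_less_infinity: "ecard A < \<infinity> \<longleftrightarrow> finite A"
  by (simp add: ecard_def)

lemma ecard_mono: "A \<subseteq> B \<Longrightarrow> ecard A \<le> ecard B"
  by (auto simp: ecard_def intro: card_mono finite_subset)

lemma ecard_Un_disjoint: "A \<inter> B = {} \<Longrightarrow> ecard (A \<union> B) = ecard A + ecard B"
  by (auto simp: ecard_def card_Un_disjoint)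

lemma ecard_leI:
  assumes "\<And>X. finite X \<Longrightarrow> X \<subseteq> A \<Longrightarrow> ecard X \<le> c"
  shows "ecard A \<le> c"
proof (cases "finite A")
  case True
  then show ?thesis using assms by simp
next
  case False
  have "enat n \<le> c" for n
  proof -
    obtain X where "finite X" "card X = n" "X \<subseteq> A"
      using infinite_arbitrarily_large[OF False] by metis
    then show ?thesis using assms[of X] by (simp add: ecard_def)
  qed
  then have "c \<noteq> enat m" for m by (metis enat_ord_simps(1) Suc_n_not_le_n)
  then show ?thesis by (cases c) auto
qed

text \<open>An infinite sum in \<open>enat\<close> is the supremum of its finite partial sums, and a
  finite subset of the union meets only finitely many pieces needed to cover it. This turns the two
  series in \<open>shift_b\<close> into cardinalities of sets of vertices.\<close>

lemma ecard_UN_disjoint: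
  assumes "disjoint_family_on F A"
  shows "ecard (\<Union>u\<in>A. F u) = (\<Sum>\<^sub>\<infinity>u\<in>A. ecard (F u))"
proof -
  have fin: "ecard (\<Union>u\<in>S. F u) = (\<Sum>u\<in>S. ecard (F u))" if "finite S" "S \<subseteq> A" for S
    using that
  proof (induction S rule: finite_induct)
    case (insert x S)
    then have "F x \<inter> (\<Union>u\<in>S. F u) = {}"
      using assms by (fastforce simp: disjoint_family_on_def)
    with insert show ?case by (simp add: ecard_Un_disjoint)
  qed (simp add: ecard_def enat_0)
  have sup: "(\<Sum>\<^sub>\<infinity>u\<in>A. ecard (F u)) = (SUP S\<in>{S. finite S \<and> S \<subseteq> A}. \<Sum>u\<in>S. ecard (F u))"
    by (rule nonneg_infsum_complete) simp
  show ?thesis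
  proof (rule antisym)
    show "ecard (\<Union>u\<in>A. F u) \<le> (\<Sum>\<^sub>\<infinity>u\<in>A. ecard (F u))"
    proof (rule ecard_leI)
      fix X assume "finite X" "X \<subseteq> (\<Union>u\<in>A. F u)"
      then obtain S where S: "finite S" "S \<subseteq> A" "X \<subseteq> (\<Union>u\<in>S. F u)"
        using finite_subset_image[of _ F A] finite_subset_Union[of X "F ` A"] by metis
      then have "ecard X \<le> (\<Sum>u\<in>S. ecard (F u))"
        using ecard_mono fin by metis
      also have "\<dots> \<le> (\<Sum>\<^sub>\<infinity>u\<in>A. ecard (F u))"
        unfolding sup using S by (intro SUP_upper) auto
      finally show "ecard X \<le> \<dots>" .
    qed
    show "(\<Sum>\<^sub>\<infinity>u\<in>A. ecard (F u)) \<le> ecard (\<Union>u\<in>A. F u)"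
      unfolding sup by (rule SUP_least) (auto simp flip: fin intro!: ecard_mono)
  qed
qed

section \<open>Membership, evaluation and approximation in \<open>ell2 V\<close>\<close>

lemma ell2_add:
  assumes "f \<in> ell2 V" "g \<in> ell2 V"
  shows "f + g \<in> ell2 V"
proof -
  have "0 - g \<in> ell2 V" using assms(2) by (simp add: ell2_def)
  from ell2_diff[OF assms(1) this] show ?thesis by simp
qed

lemma ell2_cscale:
  assumes "f \<in> ell2 V"
  shows "cscale c f \<in> ell2 V"
  using assms by (auto simp: ell2_def cscale_def norm_mult power_mult_distrib summable_on_cmult_right)

lemma zero_in_ell2: "0 \<in> ell2 V"
  by (simp add: ell2_def)

lemma finite_support_ell2:
  assumes "finite F" "F \<subseteq> V" "\<And>v. v \<notin> F \<Longrightarrow> f v = 0"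
  shows "f \<in> ell2 V"
proof -
  have "(\<lambda>v. (cmod (f v))\<^sup>2) summable_on V \<longleftrightarrow> (\<lambda>v. (cmod (f v))\<^sup>2) summable_on F"
    using assms by (intro summable_on_cong_neutral) auto
  then show ?thesis using assms by (auto simp: ell2_def summable_on_finite)
qed

lemma ell2_dominated:
  assumes "g \<in> ell2 V" "\<And>v. v \<notin> V \<Longrightarrow> f v = 0" "\<And>v. v \<in> V \<Longrightarrow> cmod (f v) \<le> c * cmod (g v)"
  shows "f \<in> ell2 V"
proof -
  have "(\<lambda>v. c\<^sup>2 * (cmod (g v))\<^sup>2) summable_on V"
    using assms(1) by (intro summable_on_cmult_right) (auto simp: ell2_def)
  moreover have "(cmod (f v))\<^sup>2 \<le> c\<^sup>2 * (cmod (g v))\<^sup>2" if "v \<in> V" for v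
    using power_mono[OF assms(3)[OF that], of 2] by (simp add: power_mult_distrib)
  ultimately have "(\<lambda>v. (cmod (f v))\<^sup>2) summable_on V"
    by (rule summable_on_comparison_test) auto
  then show ?thesis using assms(2) by (simp add: ell2_def)
qed

lemma topspace_ell2 [simp]: "topspace (ell2_topology V) = ell2 V"
  by (simp add: ell2_topology_def Metric_space.topspace_mtopology[OF Metric_space_ell2])

text \<open>Evaluation at a point is 1-Lipschitz. Hence every set cut out by equations between
  coordinates is closed, which is how the graph and the range are treated below.\<close>

lemma continuous_map_ell2_apply:
  "continuous_map (ell2_topology V) euclidean (\<lambda>f. f v)"
proof -
  interpret Metric_space "ell2 V" "ell2_dist V" by (rule Metric_space_ell2)
  have le: "dist (f v) (g v) \<le> ell2_dist V f g" if "f \<in> ell2 V" "g \<in> ell2 V" for f g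
  proof (cases "v \<in> V")
    case True
    then show ?thesis
      using L2_set_le_ell2_norm[OF ell2_diff[OF that], of "{v}"]
      by (simp add: L2_set_def dist_norm ell2_dist_def)
  next
    case False
    with that show ?thesis by (simp add: ell2_def)
  qed
  have "openin mtopology {f \<in> ell2 V. f v \<in> U}" if "open U" for U
    unfolding openin_mtopology
  proof (intro conjI allI impI)
    fix f assume f: "f \<in> {f \<in> ell2 V. f v \<in> U}"
    then obtain e where e: "e > 0" "ball (f v) e \<subseteq> U"
      using \<open>open U\<close> openE by blast
    then have "mball f e \<subseteq> {f \<in> ell2 V. f v \<in> U}"
      using le by (fastforce simp: in_mball)
    then show "\<exists>r>0. mball f r \<subseteq> {f \<in> ell2 V. f v \<in> U}" using e by blast
  qed auto
  then show ?thesis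
    by (auto simp: continuous_map_def ell2_topology_def)
qed

lemma ell2_truncation:
  assumes g: "g \<in> ell2 V" and "0 < e"
  obtains F where "finite F" "F \<subseteq> V" "ell2_dist V g (\<lambda>v. if v \<in> F then g v else 0) < e"
proof -
  let ?q = "\<lambda>v. (cmod (g v))\<^sup>2"
  have q: "?q summable_on V" using g by (simp add: ell2_def)
  \<comment> \<open>The approximation holds only with \<le>; the radius \<open>e / 2\<close> makes
    the final bound strict.\<close>
  obtain F where F: "finite F" "F \<subseteq> V" "dist (sum ?q F) (infsum ?q V) \<le> (e / 2)\<^sup>2"
    using infsum_finite_approximation[OF q, of "(e / 2)\<^sup>2"] \<open>0 < e\<close> by auto
  let ?h = "\<lambda>v. if v \<in> F then g v else 0"
  have "(\<Sum>\<^sub>\<infinity>v\<in>V. (cmod ((g - ?h) v))\<^sup>2) = infsum ?q (V - F)"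
    by (rule infsum_cong_neutral) auto
  also have "\<dots> = infsum ?q V - sum ?q F"
    using F q by (subst infsum_Diff) auto
  also have "\<dots> \<le> (e / 2)\<^sup>2" using F(3) by (simp add: dist_real_def)
  finally have "ell2_dist V g ?h \<le> sqrt ((e / 2)\<^sup>2)"
    unfolding ell2_dist_def ell2_norm_def by (rule real_sqrt_le_mono)
  also have "\<dots> < e" using \<open>0 < e\<close> by simp
  finally show ?thesis using F that by blast
qed

section \<open>Trees\<close>

context directed_tree
begin

lemma edge_vertices: "(u, v) \<in> E \<Longrightarrow> u \<in> V" "(u, v) \<in> E \<Longrightarrow> v \<in> V"
  using edges by auto

lemma parent_unique: "(u, v) \<in> E \<Longrightarrow> (u', v) \<in> E \<Longrightarrow> u = u'"
  using unique_parent[of v] edge_vertices(2) by (auto simp: is_root_def)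

lemma par_eq: "(u, v) \<in> E \<Longrightarrow> par E v = u"
  unfolding par_def using parent_unique by blast

lemma mem_children: "v \<in> children V E u \<longleftrightarrow> (u, v) \<in> E"
  using edge_vertices by (auto simp: children_def)

lemma mem_non_roots: "v \<in> non_roots V E \<longleftrightarrow> (\<exists>u. (u, v) \<in> E)"
  using edge_vertices by (auto simp: non_roots_def is_root_def)

text \<open>Walk along the undirected path from \<open>u\<close>, keeping a common ancestor
  \<open>z\<close> of \<open>u\<close> and the current vertex. A step down keeps \<open>z\<close>. A
  step up keeps \<open>z\<close> too, unless \<open>z\<close> is the current vertex, since the last
  edge of the directed path from \<open>z\<close> must come from the unique parent; in the
  exceptional case the parent replaces \<open>z\<close>.\<close>

lemma common_ancestor:
  assumes "u \<in> V" "v \<in> V"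
  obtains z where "(z, u) \<in> E\<^sup>*" "(z, v) \<in> E\<^sup>*"
proof (cases "u = v")
  case False
  then obtain p where p: "2 \<le> length p" "hd p = u" "last p = v"
      "\<And>j. Suc j < length p \<Longrightarrow> (p ! j, p ! Suc j) \<in> E \<or> (p ! Suc j, p ! j) \<in> E"
    using connected[OF assms] by auto
  have "\<exists>z. (z, u) \<in> E\<^sup>* \<and> (z, p ! j) \<in> E\<^sup>*" if "j < length p" for j
    using that
  proof (induction j)
    case 0
    then show ?case using p(1,2) by (auto simp: hd_conv_nth)
  next
    case (Suc j)
    then obtain z where z: "(z, u) \<in> E\<^sup>*" "(z, p ! j) \<in> E\<^sup>*" by auto
    from p(4)[OF Suc.prems] show ?case
    proof
      assume "(p ! j, p ! Suc j) \<in> E"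
      with z show ?thesis by (meson rtrancl_into_rtrancl)
    next
      assume e: "(p ! Suc j, p ! j) \<in> E"
      from z(2) show ?thesis
      proof (cases rule: rtranclE)
        case base
        with e z(1) have "(p ! Suc j, u) \<in> E\<^sup>*" by (simp add: converse_rtrancl_into_rtrancl)
        then show ?thesis by blast
      next
        case (step y)
        then have "y = p ! Suc j" using e parent_unique by blast
        with step z(1) show ?thesis by blast
      qed
    qed
  qed
  moreover have "p ! (length p - 1) = v"
    using p(1,3) by (subst last_conv_nth[symmetric]) auto
  moreover have "length p - 1 < length p" using p(1) by simp
  ultimately show ?thesis using that by metis
qed (use that in blast)

lemma roots_eq:
  assumes "is_root V E u" "is_root V E v"
  shows "u = v"
proof -
  have "u \<in> V" "v \<in> V" using assms by (simp_all add: is_root_def)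
  then obtain z where "(z, u) \<in> E\<^sup>*" "(z, v) \<in> E\<^sup>*"
    using common_ancestor by blast
  then show ?thesis using assms by (metis is_root_def rtranclE)
qed

lemma ecard_roots: "ecard {v. is_root V E v} = (if has_root V E then 1 else 0)"
proof (cases "has_root V E")
  case True
  then obtain r where "is_root V E r" by (auto simp: has_root_def)
  then have "{v. is_root V E v} = {r}" using roots_eq by auto
  with True show ?thesis by (simp add: ecard_def one_enat_def)
qed (simp add: has_root_def ecard_def enat_0)

lemma branching_children:
  assumes "u \<in> branching V E"
  obtains v w where "(u, v) \<in> E" "(u, w) \<in> E" "v \<noteq> w"
proof -
  have "\<not> children V E u \<subseteq> {v}" for v
  proof
    assume "children V E u \<subseteq> {v}"
    then have "ecard (children V E u) \<le> 1"
      using ecard_mono[of _ "{v}"] by (simp add: ecard_def one_enat_def split: if_splits)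
    moreover have "2 \<le> ecard (children V E u)" using assms by (simp add: branching_def)
    ultimately have "2 \<le> (1 :: enat)" by (rule order_trans[rotated])
    then show False by (simp add: numeral_eq_enat one_enat_def)
  qed
  then obtain v w where "v \<in> children V E u" "w \<in> children V E u" "v \<noteq> w"
    by blast
  then show ?thesis using that mem_children by blast
qed

lemma non_branching_child_unique:
  assumes "u \<notin> branching V E" "(u, v) \<in> E" "(u, w) \<in> E"
  shows "v = w"
proof (rule ccontr)
  assume "v \<noteq> w"
  then have "ecard {v, w} = 2" by (simp add: ecard_def numeral_eq_enat)
  moreover have "ecard {v, w} \<le> ecard (children V E u)"
    using assms by (intro ecard_mono) (simp add: mem_children)
  ultimately show False using assms edge_vertices by (auto simp: branching_def)
qed

text \<open>Below a fixed vertex there is at most one leaf that can be reached through non-branching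
  vertices only.  A leaf is reached in this way from a child of a branching vertex, except for
  leaves without branching ancestors, of which there is at most one since any two vertices have a
  common ancestor.\<close>

lemma finite_leaves:
  assumes fin: "\<And>u. u \<in> V \<Longrightarrow> finite (children V E u)" and br: "finite (branching V E)"
  shows "finite (V - non_leaves V E)"
proof -
  define D where "D = {(x, y) \<in> E. x \<notin> branching V E}"
  define C where "C = (\<Union>u\<in>branching V E. children V E u)"
  define L where "L = V - non_leaves V E"
  have leaf: "(v, x) \<notin> E" if "v \<in> L" for v x
    using that mem_children by (auto simp: L_def non_leaves_def)
  have single: "v = w" if "v \<in> L" "w \<in> L" "(c, v) \<in> D\<^sup>*" "(c, w) \<in> D\<^sup>*" for c v w
  proof -
    \<comment> \<open>A single-valued relation makes any two vertices reachable from
      \<open>c\<close> comparable, and a leaf has no outgoing edge, so comparable leaves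
      coincide.\<close>
    have "single_valued D"
      using non_branching_child_unique by (auto simp: D_def single_valued_def)
    then have "(v, w) \<in> D\<^sup>* \<or> (w, v) \<in> D\<^sup>*"
      using that by (intro single_valued_confluent)
    moreover have "(v, x) \<notin> D" "(w, x) \<notin> D" for x
      using leaf that by (auto simp: D_def)
    ultimately show ?thesis by (blast elim: converse_rtranclE)
  qed
  have fin_single: "finite A" if "\<And>x y. x \<in> A \<Longrightarrow> y \<in> A \<Longrightarrow> x = y" for A :: "'a set"
    
  proof (cases "A = {}")
    case False
    then obtain x where "x \<in> A" by auto
    then have "A \<subseteq> {x}" using that by auto
    then show ?thesis by (rule finite_subset) simp
  qed simp
  let ?A = "\<lambda>c. {v \<in> L. (c, v) \<in> D\<^sup>*}"
  let ?B = "{v \<in> L. \<forall>c\<in>C. (c, v) \<notin> D\<^sup>*}"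
  have "finite ?B"
  proof (rule fin_single)
    fix v w assume v: "v \<in> ?B" and w: "w \<in> ?B"
    \<comment> \<open>A directed path to a leaf in \<open>?B\<close> uses only edges of
      \<open>D\<close>: an edge leaving a branching vertex would end in \<open>C\<close>, and the
      rest of the path would link \<open>C\<close> to the leaf.\<close>
    have up: "(x, y) \<in> D\<^sup>*" if "(x, y) \<in> E\<^sup>*" "y \<in> ?B" for x y
      using that
    proof (induction rule: converse_rtrancl_induct)
      case (step a b)
      show ?case
      proof (cases "a \<in> branching V E")
        case True
        with step have "b \<in> C" by (auto simp: C_def mem_children)
        with step show ?thesis by auto
      next
        case False
        with step have "(a, b) \<in> D" by (simp add: D_def)
        with step show ?thesis by (meson converse_rtrancl_into_rtrancl)
      qed
    qed simp
    obtain z where "(z, v) \<in> E\<^sup>*" "(z, w) \<in> E\<^sup>*"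
      using common_ancestor v w by (auto simp: L_def)
    with up v w have "(z, v) \<in> D\<^sup>*" "(z, w) \<in> D\<^sup>*" by blast+
    with v w show "v = w" using single[of v w z] by simp
  qed
  moreover have "finite (?A c)" for c
    by (rule fin_single) (use single in auto)
  moreover have "finite C"
    using fin br by (auto simp: C_def branching_def)
  moreover have "L \<subseteq> ?B \<union> (\<Union>c\<in>C. ?A c)" by auto
  ultimately have "finite L" by (meson finite_UN finite_Un finite_subset)
  then show ?thesis by (simp add: L_def)
qed

section \<open>The shift map on vertices and its closed graph\<close>

lemma shift_map_edge: "(u, v) \<in> E \<Longrightarrow> shift_map V E lam f v = lam v * f u"
  by (auto simp: shift_map_def mem_non_roots par_eq)

lemma shift_map_no_parent: "(\<And>u. (u, v) \<notin> E) \<Longrightarrow> shift_map V E lam f v = 0"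
  by (auto simp: shift_map_def mem_non_roots)

lemma shift_map_indicator:
  "shift_map V E lam (indicator {u}) v = (if (u, v) \<in> E then lam v else 0)"
  using mem_non_roots par_eq by (auto simp: shift_map_def indicator_def)

lemma shift_map_outside: "v \<notin> V \<Longrightarrow> shift_map V E lam f v = 0"
  using edge_vertices by (intro shift_map_no_parent) auto

lemma shift_map_add: "shift_map V E lam (f + g) = shift_map V E lam f + shift_map V E lam g"
  by (auto simp: shift_map_def algebra_simps)

lemma shift_map_cscale: "shift_map V E lam (cscale c f) = cscale c (shift_map V E lam f)"
  by (auto simp: shift_map_def cscale_def)

lemma shift_map_zero: "shift_map V E lam 0 = 0"
  by (auto simp: shift_map_def)

lemma linear_operator_shift: "linear_operator V (weighted_shift V E lam)"
proof -
  have mem: "(f, g) \<in> weighted_shift V E lam \<longleftrightarrow>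
      f \<in> ell2 V \<and> g \<in> ell2 V \<and> g = shift_map V E lam f" for f g
    by (auto simp: weighted_shift_def)
  show ?thesis
    unfolding linear_operator_def single_valued_def subset_iff split_paired_All mem
    by (simp add: shift_map_zero zero_in_ell2 shift_map_add ell2_add shift_map_cscale ell2_cscale)
qed

text \<open>The graph is an intersection of sets \<open>?C v\<close>, each given by one equation
  between continuous coordinates of the pair.\<close>

lemma closed_operator_shift: "closed_operator V (weighted_shift V E lam)"
proof -
  let ?P = "prod_topology (ell2_topology V) (ell2_topology V)"
  let ?m = "\<lambda>v z. if v \<in> non_roots V E then lam v * z else 0"
  let ?C = "\<lambda>v. {p \<in> topspace ?P. snd p v = ?m v (fst p (par E v))}"
  have "closedin ?P (?C v)" for v
  proof (rule closedin_continuous_maps_eq)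
    show "continuous_map ?P euclidean (\<lambda>p. snd p v)"
      using continuous_map_compose[OF continuous_map_snd continuous_map_ell2_apply]
      by (simp add: o_def)
    have "continuous_map ?P euclidean (\<lambda>p. fst p (par E v))"
      using continuous_map_compose[OF continuous_map_fst continuous_map_ell2_apply]
      by (simp add: o_def)
    moreover have "continuous_map euclidean euclidean (?m v)"
      by (cases "v \<in> non_roots V E") (auto intro!: continuous_intros)
    ultimately show "continuous_map ?P euclidean (\<lambda>p. ?m v (fst p (par E v)))"
      using continuous_map_compose[of ?P euclidean "\<lambda>p. fst p (par E v)" euclidean "?m v"]
      by (simp add: o_def)
  qed simp
  then have "closedin ?P (\<Inter>v. ?C v)" by (intro closedin_INT) auto
  moreover have "(\<Inter>v. ?C v) = weighted_shift V E lam"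
  proof (intro set_eqI)
    fix p
    have "p \<in> (\<Inter>v. ?C v) \<longleftrightarrow> fst p \<in> ell2 V \<and> snd p \<in> ell2 V \<and> snd p = shift_map V E lam (fst p)"
      unfolding shift_map_def by (cases p) (simp add: fun_eq_iff)
    then show "p \<in> (\<Inter>v. ?C v) \<longleftrightarrow> p \<in> weighted_shift V E lam"
      unfolding weighted_shift_def by (cases p) auto
  qed
  ultimately show ?thesis
    by (simp add: closed_operator_def linear_operator_shift)
qed

end

section \<open>Kernels and range of the shift\<close>

text \<open>The range arguments need a uniform lower bound \<open>d\<close> rather than an infimum.
  With no qualifying vertex the infimum is \<infinity> and any \<open>d\<close> serves.\<close>

lemma shift_c_pos_iff:
  "0 < shift_c V E lam \<longleftrightarrow>
     (\<exists>d>0. \<forall>u\<in>non_roots V E. lam u \<noteq> 0 \<longrightarrow> ecard (children V E (par E u)) = 1 \<longrightarrow> d \<le> cmod (lam u))"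
proof
  assume "0 < shift_c V E lam"
  then obtain d where d: "0 < ereal d" "ereal d < shift_c V E lam"
    using ereal_dense2 by blast
  have "d \<le> cmod (lam u)"
    if "u \<in> non_roots V E" "lam u \<noteq> 0" "ecard (children V E (par E u)) = 1" for u
  proof -
    have "shift_c V E lam \<le> ereal (cmod (lam u))"
      unfolding shift_c_def using that by (intro Inf_lower) auto
    with d(2) have "ereal d \<le> ereal (cmod (lam u))" by (meson less_le_trans order_less_imp_le)
    then show ?thesis by simp
  qed
  with d(1) show "\<exists>d>0. \<forall>u\<in>non_roots V E. lam u \<noteq> 0 \<longrightarrow>
      ecard (children V E (par E u)) = 1 \<longrightarrow> d \<le> cmod (lam u)" by auto
next
  assume "\<exists>d>0. \<forall>u\<in>non_roots V E. lam u \<noteq> 0 \<longrightarrow>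
      ecard (children V E (par E u)) = 1 \<longrightarrow> d \<le> cmod (lam u)"
  then obtain d where d: "d > 0" "\<And>u. u \<in> non_roots V E \<Longrightarrow> lam u \<noteq> 0 \<Longrightarrow>
      ecard (children V E (par E u)) = 1 \<Longrightarrow> d \<le> cmod (lam u)" by blast
  have "ereal d \<le> shift_c V E lam"
    unfolding shift_c_def using d(2) by (intro Inf_greatest) auto
  with d(1) show "0 < shift_c V E lam" by (meson ereal_less(2) less_le_trans)
qed

locale dense_weighted_shift = directed_tree V E
  for V :: "'a set" and E :: "('a \<times> 'a) set" +
  fixes lam :: "'a \<Rightarrow> complex"
  assumes dense: "densely_defined V (weighted_shift V E lam)"
begin

abbreviation "S \<equiv> weighted_shift V E lam"
abbreviation "L \<equiv> shift_map V E lam"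
abbreviation "Vp \<equiv> V_plus V E lam"

section \<open>Consequences of a dense domain\<close>

lemma mem_shift: "(f, g) \<in> S \<longleftrightarrow> f \<in> ell2 V \<and> g \<in> ell2 V \<and> g = L f"
  by (auto simp: weighted_shift_def)

lemma indicator_ell2: "u \<in> V \<Longrightarrow> indicator {u} \<in> ell2 V"
  by (rule finite_support_ell2[of "{u}"]) (auto simp: indicator_def)

text \<open>On the children of \<open>u\<close>, \<open>L f\<close> is \<open>f u\<close> times the
  image of the basis vector at \<open>u\<close>. If that image is not square summable, all
  \<open>f\<close> in the domain vanish at \<open>u\<close>, so the domain lies in a proper closed
  subspace.\<close>

lemma shift_indicator_ell2:
  assumes "u \<in> V"
  shows "L (indicator {u}) \<in> ell2 V"
proof (rule ccontr)
  assume not: "L (indicator {u}) \<notin> ell2 V"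
  have "f u = 0" if f: "(f, g) \<in> S" for f g
  proof (rule ccontr)
    assume nz: "f u \<noteq> 0"
    have "L (indicator {u}) \<in> ell2 V"
    proof (rule ell2_dominated)
      show "g \<in> ell2 V" using f by (auto simp: mem_shift)
      show "cmod (L (indicator {u}) v) \<le> inverse (cmod (f u)) * cmod (g v)" for v
        using f nz
        by (auto simp: mem_shift shift_map_indicator shift_map_edge norm_mult field_simps)
    qed (rule shift_map_outside)
    with not show False by simp
  qed
  then have "Domain S \<subseteq> {f \<in> topspace (ell2_topology V). f u = 0}"
    by (auto simp: mem_shift)
  moreover have "closedin (ell2_topology V) {f \<in> topspace (ell2_topology V). f u = 0}"
    by (intro closedin_continuous_maps_eq[of euclidean] continuous_map_ell2_apply) simp_all
  ultimately have "ell2 V \<subseteq> {f \<in> topspace (ell2_topology V). f u = 0}"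
    using dense closure_of_minimal[of "Domain S" _ "ell2_topology V"]
    unfolding densely_defined_def by simp
  with indicator_ell2[OF assms] show False by auto
qed

lemma finite_support_in_domain:
  assumes "finite F" "F \<subseteq> V" "\<And>v. v \<notin> F \<Longrightarrow> f v = 0"
  shows "(f, L f) \<in> S"
proof -
  let ?s = "\<Sum>u\<in>F. cscale (f u) (indicator {u})"
  have "(?s, L ?s) \<in> S"
    using assms(1,2)
  proof (induction F rule: finite_induct)
    case empty
    have "(0, L 0) \<in> S" by (simp only: mem_shift zero_in_ell2 shift_map_zero)
    then show ?case by (simp only: sum.empty)
  next
    case (insert u F)
    then have "(cscale (f u) (indicator {u}), L (cscale (f u) (indicator {u}))) \<in> S"
      by (simp add: mem_shift shift_map_cscale ell2_cscale indicator_ell2 shift_indicator_ell2)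
    moreover have "(\<Sum>u\<in>F. cscale (f u) (indicator {u}), L (\<Sum>u\<in>F. cscale (f u) (indicator {u}))) \<in> S"
      using insert by blast
    ultimately show ?case
      unfolding sum.insert[OF insert(1,2)] mem_shift shift_map_add by (blast intro: ell2_add)
  qed
  moreover have "?s = f"
  proof
    fix v
    have "?s v = (\<Sum>u\<in>F. if v = u then f u else 0)"
      unfolding sum_fun_apply cscale_def by (intro sum.cong) (auto simp: indicator_def)
    then show "?s v = f v" using assms by simp
  qed
  ultimately show ?thesis by simp
qed

text \<open>The infinite sum of a non-summable family is 0 by convention, so a nonzero weight forces
  a positive norm only because the image of the basis vector is known to lie in
  \<open>ell2 V\<close>.\<close>

lemma mem_V_plus: "u \<in> Vp \<longleftrightarrow> (\<exists>v. (u, v) \<in> E \<and> lam v \<noteq> 0)"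
proof
  assume "u \<in> Vp"
  then have "(\<Sum>\<^sub>\<infinity>v\<in>V. (cmod (L (indicator {u}) v))\<^sup>2) \<noteq> 0"
    by (auto simp: V_plus_def ell2_norm_def)
  then obtain v where "L (indicator {u}) v \<noteq> 0"
    using infsum_0[of V "\<lambda>v. (cmod (L (indicator {u}) v))\<^sup>2"] by fastforce
  then show "\<exists>v. (u, v) \<in> E \<and> lam v \<noteq> 0"
    by (auto simp: shift_map_indicator split: if_splits)
next
  assume "\<exists>v. (u, v) \<in> E \<and> lam v \<noteq> 0"
  then obtain v where v: "(u, v) \<in> E" "lam v \<noteq> 0" by blast
  then have "cmod (lam v) \<le> ell2_norm V (L (indicator {u}))"
    using L2_set_le_ell2_norm[OF shift_indicator_ell2, of u "{v}"] edge_vertices[OF v(1)]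
    by (simp add: shift_map_indicator)
  moreover have "0 < cmod (lam v)" using v by simp
  ultimately have "0 < ell2_norm V (L (indicator {u}))" by linarith
  then show "u \<in> Vp"
    using v edge_vertices by (auto simp: V_plus_def)
qed

section \<open>Kernel of the shift\<close>

lemma null_space_shift: "f \<in> null_space S \<longleftrightarrow> f \<in> ell2 V \<and> (\<forall>u\<in>Vp. f u = 0)"
proof -
  have "L f = 0 \<longleftrightarrow> (\<forall>u v. (u, v) \<in> E \<longrightarrow> lam v * f u = 0)"
  proof
    assume "L f = 0"
    then show "\<forall>u v. (u, v) \<in> E \<longrightarrow> lam v * f u = 0"
      by (auto simp flip: shift_map_edge)
  next
    assume *: "\<forall>u v. (u, v) \<in> E \<longrightarrow> lam v * f u = 0"
    show "L f = 0"
    proof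
      fix v
      show "L f v = 0 v"
        using * shift_map_edge shift_map_no_parent by (cases "\<exists>u. (u, v) \<in> E") auto
    qed
  qed
  moreover have "f \<in> null_space S \<longleftrightarrow> f \<in> ell2 V \<and> L f = 0"
    by (auto simp: null_space_def mem_shift zero_in_ell2)
  ultimately show ?thesis
    using mem_V_plus by auto
qed

lemma null_space_shift_dim:
  "finite_dimensional (null_space S) \<longleftrightarrow> finite (V - Vp)"
  "finite (V - Vp) \<Longrightarrow> cfun.dim (null_space S) = card (V - Vp)"
proof -
  have sub: "cfun.subspace (null_space S)"
    by (auto simp: cfun.subspace_def null_space_shift zero_in_ell2 ell2_add ell2_cscale)
      (auto simp: cscale_def)
  have ind: "indicator {w} \<in> null_space S" if "w \<in> V - Vp" for w
    using that indicator_ell2 by (auto simp: null_space_shift indicator_def)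
  have zero: "f = 0" if "f \<in> null_space S" "\<And>w. w \<in> V - Vp \<Longrightarrow> f w = 0" for f
  proof
    fix v
    show "f v = 0 v"
      using that by (cases "v \<in> V") (auto simp: null_space_shift ell2_def)
  qed
  \<comment> \<open>The vertices outside \<open>Vp\<close> are the coordinates, with the basis
    vectors themselves as dual basis.\<close>
  note * = finite_dimensional_coordinates[of "null_space S" "V - Vp" "\<lambda>w. indicator {w}",
      OF sub ind _ zero]
  show "finite_dimensional (null_space S) \<longleftrightarrow> finite (V - Vp)"
    by (rule *(1)) (auto simp: indicator_def)
  show "cfun.dim (null_space S) = card (V - Vp)" if "finite (V - Vp)"
    using that by (rule *(2)[rotated -1]) (auto simp: indicator_def)
qed

section \<open>Pivots and the kernel of the adjoint\<close>

definition pivot :: "'a \<Rightarrow> 'a" where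
  "pivot u = (SOME v. (u, v) \<in> E \<and> lam v \<noteq> 0)"

lemma pivot: "u \<in> Vp \<Longrightarrow> (u, pivot u) \<in> E" "u \<in> Vp \<Longrightarrow> lam (pivot u) \<noteq> 0"
  using someI_ex[of "\<lambda>v. (u, v) \<in> E \<and> lam v \<noteq> 0"] by (auto simp: pivot_def mem_V_plus)

definition free_vertices :: "'a set" where
  "free_vertices = V - pivot ` Vp"

text \<open>A pivot is a child of its own vertex, so by uniqueness of parents \<open>v\<close> can
  be the pivot of \<open>u\<close> only. Outside \<open>Vp\<close> the value of \<open>pivot\<close>
  is arbitrary, hence the guard.\<close>

lemma child_free_iff: "(u, v) \<in> E \<Longrightarrow> v \<in> free_vertices \<longleftrightarrow> (u \<in> Vp \<longrightarrow> v \<noteq> pivot u)"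
  using pivot(1) parent_unique edge_vertices by (fastforce simp: free_vertices_def)

lemma root_free: "is_root V E v \<Longrightarrow> v \<in> free_vertices"
  using pivot(1) by (fastforce simp: free_vertices_def is_root_def)

lemma null_space_adjoint:
  "g \<in> null_space (adjoint_op V S) \<longleftrightarrow> 
    g \<in> ell2 V \<and> (\<forall>f\<in>ell2 V. L f \<in> ell2 V \<longrightarrow> ell2_inner V (L f) g = 0)"
  by (auto simp: null_space_def adjoint_op_def zero_in_ell2 ell2_inner_def weighted_shift_def)

lemma ell2_inner_finite:
  assumes "finite F" "F \<subseteq> V" "\<And>v. v \<in> V - F \<Longrightarrow> f v * cnj (g v) = 0"
  shows "ell2_inner V f g = (\<Sum>v\<in>F. f v * cnj (g v))"
proof -
  have "ell2_inner V f g = (\<Sum>\<^sub>\<infinity>v\<in>F. f v * cnj (g v))"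
    unfolding ell2_inner_def using assms by (intro infsum_cong_neutral) auto
  with assms show ?thesis by simp
qed

lemma null_space_adjoint_dim:
  "finite_dimensional (null_space (adjoint_op V S)) \<longleftrightarrow> finite free_vertices"
  "finite free_vertices \<Longrightarrow> cfun.dim (null_space (adjoint_op V S)) = card free_vertices"
proof -
  let ?N = "null_space (adjoint_op V S)"
  \<comment> \<open>The basis vector at \<open>w\<close>, corrected at the pivot of the parent when
    the parent lies in \<open>Vp\<close>. The coefficient solves
    \<open>lam w + lam v * cnj x = 0\<close> for \<open>x\<close>, which is orthogonality to the
    image of the parent's basis vector.\<close>
  define h where "h w = (\<lambda>v. if v = w then 1
      else if \<exists>u\<in>Vp. (u, w) \<in> E \<and> v = pivot u then - cnj (lam w / lam v) else 0)" for w
  have sub: "cfun.subspace ?N"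
  proof -
    have inner_add: "ell2_inner V k (f + g) = ell2_inner V k f + ell2_inner V k g"
      if "k \<in> ell2 V" "f \<in> ell2 V" "g \<in> ell2 V" for k f g
    proof -
      have sq: "(\<lambda>v. cmod (f v * f v)) summable_on V"
          "(\<lambda>v. cmod (cnj (f v) * cnj (f v))) summable_on V"
        if "f \<in> ell2 V" for f
        using that by (simp_all add: ell2_def norm_mult power2_eq_square)
      have summable: "(\<lambda>v. k v * cnj (f v)) summable_on V" if "k \<in> ell2 V" "f \<in> ell2 V" for k f
        by (rule abs_summable_summable, rule abs_summable_product) (use sq that in blast)+
      have "ell2_inner V k (f + g) = (\<Sum>\<^sub>\<infinity>v\<in>V. k v * cnj (f v) + k v * cnj (g v))"
        by (simp add: ell2_inner_def algebra_simps)
      also have "\<dots> = ell2_inner V k f + ell2_inner V k g"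
        unfolding ell2_inner_def using that summable by (intro infsum_add) auto
      finally show ?thesis .
    qed
    have inner_scale: "ell2_inner V k (cscale c f) = cnj c * ell2_inner V k f" for k f c
    proof -
      have "ell2_inner V k (cscale c f) = (\<Sum>\<^sub>\<infinity>v\<in>V. cnj c * (k v * cnj (f v)))"
        by (simp add: ell2_inner_def cscale_def mult_ac)
      then show ?thesis by (simp add: ell2_inner_def infsum_cmult_right')
    qed
    show ?thesis
      unfolding cfun.subspace_def
      by (auto simp: null_space_adjoint zero_in_ell2 ell2_add ell2_cscale inner_add
          inner_scale ell2_inner_def[of _ _ 0])
  qed
  have h_eq: "h w w' = (if w = w' then 1 else 0)" if "w \<in> free_vertices" "w' \<in> free_vertices" for w w'
    using that by (auto simp: h_def free_vertices_def)
  have h_mem: "h w \<in> ?N" if w: "w \<in> free_vertices" for w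
  proof -
    have wV: "w \<in> V" using w by (simp add: free_vertices_def)
    show ?thesis
    proof (cases "\<exists>u\<in>Vp. (u, w) \<in> E")
      case True
      then obtain u where u: "u \<in> Vp" "(u, w) \<in> E" by blast
      define p where "p = pivot u"
      have p: "(u, p) \<in> E" "lam p \<noteq> 0" "p \<in> V" "p \<noteq> w"
        using pivot[OF u(1)] edge_vertices(2) u child_free_iff w by (auto simp: p_def)
      have h: "h w = (\<lambda>v. if v = w then 1 else if v = p then - cnj (lam w / lam p) else 0)"
        using u parent_unique by (auto simp: h_def p_def fun_eq_iff)
      have "h w \<in> ell2 V"
        by (rule finite_support_ell2[of "{w, p}"]) (use wV p in \<open>auto simp: h\<close>)
      moreover have "ell2_inner V (L f) (h w) = 0" for f
      proof -
        have "ell2_inner V (L f) (h w) = (\<Sum>v\<in>{w, p}. L f v * cnj (h w v))"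
          by (rule ell2_inner_finite) (use wV p in \<open>auto simp: h\<close>)
        then show ?thesis
          using p u by (auto simp: h shift_map_edge)
      qed
      ultimately show ?thesis by (auto simp: null_space_adjoint mem_shift)
    next
      case False
      then have h: "h w = indicator {w}"
        by (auto simp: h_def indicator_def fun_eq_iff)
      \<comment> \<open>Either \<open>w\<close> has no parent, or its parent lies outside
        \<open>Vp\<close> and thus \<open>lam w = 0\<close>.\<close>
      have "L f w = 0" for f
      proof (cases "\<exists>u. (u, w) \<in> E")
        case True
        then obtain u where "(u, w) \<in> E" by blast
        with False mem_V_plus show ?thesis by (auto simp: shift_map_edge)
      qed (simp add: shift_map_no_parent)
      then have "ell2_inner V (L f) (h w) = 0" for f
        using ell2_inner_finite[of "{w}" "L f" "h w"] wV by (simp add: h)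
      then show ?thesis
        using indicator_ell2[OF wV] by (auto simp: null_space_adjoint mem_shift h)
    qed
  qed
  have zero: "g = 0" if g: "g \<in> ?N" and free: "\<And>w. w \<in> free_vertices \<Longrightarrow> g w = 0" for g
  proof
    fix v
    show "g v = 0 v"
    proof (cases "v \<in> free_vertices \<or> v \<notin> V")
      case True
      with g free show ?thesis by (auto simp: null_space_adjoint ell2_def)
    next
      case False
      then obtain u where u: "u \<in> Vp" "v = pivot u" by (auto simp: free_vertices_def)
      note e = pivot[OF u(1), folded u(2)]
      have "(indicator {u}, L (indicator {u})) \<in> S"
        using edge_vertices e by (auto simp: mem_shift indicator_ell2 shift_indicator_ell2)
      then have "ell2_inner V (L (indicator {u})) g = 0"
        using g by (simp add: null_space_adjoint mem_shift)
      \<comment> \<open>All children of \<open>u\<close> other than the pivot are free, so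
        \<open>g\<close> vanishes there and a single term survives.\<close>
      moreover have "ell2_inner V (L (indicator {u})) g = (\<Sum>w\<in>{v}. L (indicator {u}) w * cnj (g w))"
        using edge_vertices e free u child_free_iff
        by (intro ell2_inner_finite) (auto simp: shift_map_indicator)
      ultimately show ?thesis using e by (simp add: shift_map_indicator)
    qed
  qed
  note * = finite_dimensional_coordinates[of ?N free_vertices h, OF sub h_mem h_eq zero]
  show "finite_dimensional ?N \<longleftrightarrow> finite free_vertices" by (rule *(1))
  show "cfun.dim ?N = card free_vertices" if "finite free_vertices" using that by (rule *(2)[rotated -1])
qed

section \<open>Counting the free vertices\<close>

text \<open>Free vertices are sorted by their parent: the root has none, a parent in
  \<open>Vp\<close> contributes all its children but the pivot (\<open>?P\<close>), and any other
  parent contributes all its children (\<open>?Q\<close>).\<close>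

lemma ecard_free_vertices:
  "ecard free_vertices = shift_b V E lam + (if has_root V E then 1 else 0)"
proof -
  let ?Ch = "children V E"
  let ?P = "\<Union>u\<in>Vp. ?Ch u - {pivot u}"
  let ?Q = "\<Union>u\<in>non_leaves V E - Vp. ?Ch u"
  have "free_vertices = {v. is_root V E v} \<union> (?P \<union> ?Q)"
  proof (intro set_eqI)
    fix v
    show "v \<in> free_vertices \<longleftrightarrow> v \<in> {v. is_root V E v} \<union> (?P \<union> ?Q)"
    proof (cases "\<exists>u. (u, v) \<in> E")
      case True
      then obtain u where u: "(u, v) \<in> E" by blast
      then have "v \<in> ?Ch u' \<longleftrightarrow> u' = u" for u'
        using parent_unique by (auto simp: mem_children)
      moreover have "u \<in> non_leaves V E"
        using u edge_vertices mem_children by (auto simp: non_leaves_def)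
      moreover have "\<not> is_root V E v" using u by (auto simp: is_root_def)
      ultimately show ?thesis using child_free_iff[OF u] by auto
    next
      case False
      then show ?thesis
        using root_free by (auto simp: mem_children is_root_def free_vertices_def)
    qed
  qed
  moreover have "{v. is_root V E v} \<inter> (?P \<union> ?Q) = {}"
    by (auto simp: is_root_def mem_children)
  moreover have "?P \<inter> ?Q = {}"
    by (auto simp: mem_children dest: parent_unique)
  moreover have "ecard ?P = (\<Sum>\<^sub>\<infinity>u\<in>Vp. ecard (?Ch u) - 1)"
  proof -
    have "ecard ?P = (\<Sum>\<^sub>\<infinity>u\<in>Vp. ecard (?Ch u - {pivot u}))"
      by (rule ecard_UN_disjoint) (auto simp: disjoint_family_on_def mem_children dest: parent_unique)
    \<comment> \<open>Removing the pivot lowers a finite count by one; for infinitely many children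
      both sides are \<infinity>.\<close>
    also have "\<dots> = (\<Sum>\<^sub>\<infinity>u\<in>Vp. ecard (?Ch u) - 1)"
      by (intro infsum_cong) (auto simp: ecard_def one_enat_def mem_children pivot)
    finally show ?thesis .
  qed
  moreover have "ecard ?Q = (\<Sum>\<^sub>\<infinity>u\<in>non_leaves V E - Vp. ecard (?Ch u))"
    by (rule ecard_UN_disjoint) (auto simp: disjoint_family_on_def mem_children dest: parent_unique)
  ultimately show ?thesis
    by (simp add: ecard_Un_disjoint ecard_roots shift_b_def add_ac)
qed

text \<open>A set of siblings contains at most one pivot, so branching vertices, and non-leaves
  outside \<open>Vp\<close>, all have a free child and lie in the image of
  \<open>free_vertices\<close> under \<open>par E\<close>. Conversely, the parent of a free vertex
  is of one of these two kinds.\<close>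

lemma finite_free_vertices_iff:
  "finite free_vertices \<longleftrightarrow> (\<forall>u\<in>V. finite (children V E u)) \<and> finite (branching V E) \<and>
     finite (non_leaves V E - Vp)"
proof
  assume fin: "finite free_vertices"
  have "finite (children V E u)" for u
  proof -
    have "children V E u \<subseteq> insert (pivot u) free_vertices"
      using child_free_iff by (auto simp: mem_children)
    with fin show ?thesis by (meson finite_insert finite_subset)
  qed
  moreover have "branching V E \<subseteq> par E ` free_vertices"
  proof
    fix u assume "u \<in> branching V E"
    then obtain v w where "(u, v) \<in> E" "(u, w) \<in> E" "v \<noteq> w" by (rule branching_children)
    then obtain x where "(u, x) \<in> E" "x \<noteq> pivot u" by metis
    then show "u \<in> par E ` free_vertices" using child_free_iff par_eq by (metis imageI)
  qed
  moreover have "non_leaves V E - Vp \<subseteq> par E ` free_vertices"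
  proof
    fix u assume u: "u \<in> non_leaves V E - Vp"
    then obtain v where "(u, v) \<in> E" using mem_children by (auto simp: non_leaves_def)
    with u show "u \<in> par E ` free_vertices" using child_free_iff par_eq by (metis DiffD2 imageI)
  qed
  ultimately show "(\<forall>u\<in>V. finite (children V E u)) \<and> finite (branching V E) \<and>
      finite (non_leaves V E - Vp)"
    using fin by (meson finite_imageI finite_subset)
next
  assume fin: "(\<forall>u\<in>V. finite (children V E u)) \<and> finite (branching V E) \<and>
      finite (non_leaves V E - Vp)"
  let ?U = "branching V E \<union> (non_leaves V E - Vp)"
  have "free_vertices \<subseteq> {v. is_root V E v} \<union> (\<Union>u\<in>?U. children V E u)"
  proof
    fix v assume v: "v \<in> free_vertices"
    show "v \<in> {v. is_root V E v} \<union> (\<Union>u\<in>?U. children V E u)"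
    proof (cases "\<exists>u. (u, v) \<in> E")
      case True
      then obtain u where u: "(u, v) \<in> E" by blast
      have "u \<in> ?U"
      proof (cases "u \<in> Vp")
        case True
        with v u have "v \<noteq> pivot u" by (simp add: child_free_iff)
        then have "u \<in> branching V E"
          using non_branching_child_unique[OF _ u pivot(1)[OF True]] by blast
        then show ?thesis by simp
      next
        case False
        with u edge_vertices mem_children show ?thesis by (auto simp: non_leaves_def)
      qed
      with u show ?thesis by (auto simp: mem_children)
    next
      case False
      with v show ?thesis by (auto simp: is_root_def free_vertices_def)
    qed
  qed
  moreover have "finite {v. is_root V E v}"
    unfolding ecard_less_infinity[symmetric] ecard_roots
    by (simp add: one_enat_def zero_enat_def)
  moreover have "finite (\<Union>u\<in>?U. children V E u)"
    using fin by (auto simp: branching_def non_leaves_def)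
  ultimately show "finite free_vertices" by (meson finite_Un finite_subset)
qed

text \<open>A vertex outside \<open>Vp\<close> is a leaf or a non-leaf outside \<open>Vp\<close>.
  This bounds the kernel of the shift once the kernel of the adjoint is finite dimensional.\<close>

lemma finite_not_V_plus:
  assumes "finite free_vertices"
  shows "finite (V - Vp)"
proof -
  have "finite (V - non_leaves V E)" "finite (non_leaves V E - Vp)"
    using assms finite_leaves by (auto simp: finite_free_vertices_iff)
  then show ?thesis by (rule finite_subset[rotated, OF finite_UnI]) auto
qed

section \<open>Closedness of the range\<close>

text \<open>If \<open>lam\<close> takes arbitrarily small nonzero values at only children, then a square summable
  \<open>g\<close> built from such values is a limit of images of finitely supported functions, but the only
  candidate for a preimage of \<open>g\<close> takes the value 1 infinitely often.\<close>

lemma closed_range_imp_shift_c_pos: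
  assumes closed: "closedin (ell2_topology V) (Range S)"
  shows "0 < shift_c V E lam"
proof (rule ccontr)
  define A where "A = {v \<in> non_roots V E. lam v \<noteq> 0 \<and> ecard (children V E (par E v)) = 1}"
  assume "\<not> 0 < shift_c V E lam"
  then have small: "\<exists>u\<in>A. cmod (lam u) < d" if "d > 0" for d
    using that by (force simp: shift_c_pos_iff A_def not_le)
  have only_child: "v = x" if "x \<in> A" "(u, x) \<in> E" "(u, v) \<in> E" for u v x
  proof -
    have "u \<notin> branching V E"
      using that par_eq by (auto simp: A_def branching_def one_enat_def numeral_eq_enat)
    with that show ?thesis using non_branching_child_unique by blast
  qed
  have edge: "(par E x, x) \<in> E" if "x \<in> A" for x
    using that par_eq by (auto simp: A_def mem_non_roots)
  have par_inj: "v = x" if "x \<in> A" "v \<in> A" "par E v = par E x" for v x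
    using only_child[OF that(1) edge[OF that(1)]] edge[OF that(2)] that(3) by simp
  \<comment> \<open>The bound \<open>(1 / 2) ^ n\<close> makes the weights along \<open>s\<close>
    square summable; their strict decrease makes \<open>s\<close> injective.\<close>
  have "\<exists>s :: nat \<Rightarrow> 'a. \<forall>n. (s n \<in> A \<and> cmod (lam (s n)) < (1 / 2) ^ n) \<and>
      cmod (lam (s (Suc n))) < cmod (lam (s n))"
  proof (rule dependent_nat_choice)
    show "\<exists>x. x \<in> A \<and> cmod (lam x) < (1 / 2) ^ 0" using small[of 1] by auto
    fix x n assume "x \<in> A \<and> cmod (lam x) < (1 / 2) ^ n"
    then have "0 < min ((1 / 2) ^ Suc n) (cmod (lam x))" by (simp add: A_def)
    from small[OF this] show "\<exists>y. (y \<in> A \<and> cmod (lam y) < (1 / 2) ^ Suc n) \<and>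
        cmod (lam y) < cmod (lam x)" by auto
  qed
  then obtain s :: "nat \<Rightarrow> 'a" where s: "\<And>n. s n \<in> A" "\<And>n. cmod (lam (s n)) < (1 / 2) ^ n"
      "\<And>n. cmod (lam (s (Suc n))) < cmod (lam (s n))" by blast
  have "strict_mono (\<lambda>n. - cmod (lam (s n)))"
    using s(3) by (simp add: strict_mono_Suc_iff)
  then have inj: "inj s"
    by (metis (mono_tags, lifting) injI strict_mono_eq)
  have sV: "range s \<subseteq> V" using s(1) by (auto simp: A_def non_roots_def)
  define g where "g v = (if v \<in> range s then lam v else 0)" for v
  have g: "g \<in> ell2 V"
  proof -
    have "(\<lambda>n. (cmod (lam (s n)))\<^sup>2) summable_on UNIV"
    proof (rule norm_summable_imp_summable_on, rule summable_comparison_test')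
      show "summable (\<lambda>n. (1 / 4 :: real) ^ n)" by (simp add: summable_geometric)
      fix n :: nat
      have "(cmod (lam (s n)))\<^sup>2 \<le> ((1 / 2) ^ n)\<^sup>2"
        using s(2)[of n] by (intro power_mono) auto
      also have "\<dots> = (1 / 4) ^ n" by (simp add: power2_eq_square flip: power_mult_distrib)
      finally show "norm (norm ((cmod (lam (s n)))\<^sup>2)) \<le> (1 / 4) ^ n" by simp
    qed
    then have "(\<lambda>v. (cmod (lam v))\<^sup>2) summable_on range s"
      using summable_on_reindex[OF inj, of "\<lambda>v. (cmod (lam v))\<^sup>2"] by (simp add: o_def)
    also have "?this \<longleftrightarrow> (\<lambda>v. (cmod (g v))\<^sup>2) summable_on V"
      using sV by (intro summable_on_cong_neutral) (auto simp: g_def)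
    finally show ?thesis using sV by (auto simp: ell2_def g_def)
  qed
  interpret Metric_space "ell2 V" "ell2_dist V" by (rule Metric_space_ell2)
  have "g \<in> mtopology closure_of (Range S)"
    unfolding metric_closure_of
  proof (intro CollectI conjI allI impI)
    fix e :: real assume "0 < e"
    then obtain F where F: "finite F" "F \<subseteq> V" "ell2_dist V g (\<lambda>v. if v \<in> F then g v else 0) < e"
      using ell2_truncation[OF g] by metis
    let ?G = "par E ` (F \<inter> range s)"
    let ?f = "\<lambda>u. if u \<in> ?G then 1 else 0"
    have "?G \<subseteq> V" using edge s(1) edge_vertices(1) by blast
    then have f: "(?f, L ?f) \<in> S"
      using F(1) by (intro finite_support_in_domain[of ?G]) auto
    \<comment> \<open>The vertices of \<open>range s\<close> are only children, so the image of the
      indicator of their parents has no values at siblings and is exactly the truncation of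
      \<open>g\<close>.\<close>
    have Lf: "L ?f = (\<lambda>v. if v \<in> F then g v else 0)"
    proof
      fix v
      show "L ?f v = (if v \<in> F then g v else 0)"
      proof (cases "\<exists>u. (u, v) \<in> E")
        case True
        then obtain u where u: "(u, v) \<in> E" by blast
        have "u \<in> ?G \<longleftrightarrow> v \<in> F \<inter> range s"
        proof
          assume "u \<in> ?G"
          then obtain x where "x \<in> F \<inter> range s" "u = par E x" by blast
          with only_child[of x u v] edge s(1) u show "v \<in> F \<inter> range s" by auto
        qed (use par_eq[OF u] in blast)
        then show ?thesis using u by (simp add: shift_map_edge g_def)
      next
        case False
        with edge s(1) have "v \<notin> range s" by blast
        with False show ?thesis by (simp add: shift_map_no_parent g_def)
      qed
    qed
    have "L ?f \<in> ell2 V" using f unfolding mem_shift by blast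
    then have "L ?f \<in> mball g e" using F(3) g by (simp add: Lf)
    with f show "\<exists>y\<in>Range S. y \<in> mball g e" by blast
  qed (rule g)
  then have "g \<in> Range S"
    using closed by (simp add: closure_of_closedin ell2_topology_def)
  then obtain f where f: "f \<in> ell2 V" "g = L f" by (auto simp: mem_shift)
  have one: "f (par E (s n)) = 1" for n
  proof -
    have "lam (s n) = g (s n)" by (simp add: g_def)
    also have "\<dots> = lam (s n) * f (par E (s n))"
      unfolding f(2) by (rule shift_map_edge[OF edge[OF s(1)]])
    finally have "lam (s n) = lam (s n) * f (par E (s n))" .
    then show ?thesis using s(1)[of n] by (simp add: A_def)
  qed
  \<comment> \<open>The preimage is 1 at \<open>n\<close> distinct parents, so its squared norm is
    at least \<open>n\<close>, for every \<open>n\<close>.\<close>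
  obtain n where n: "(ell2_norm V f)\<^sup>2 < real n" using reals_Archimedean2 by blast
  have inj': "inj (\<lambda>n. par E (s n))"
    using par_inj s(1) inj by (metis (mono_tags, lifting) inj_def)
  have "L2_set (\<lambda>v. cmod (f v)) ((\<lambda>n. par E (s n)) ` {..<n}) \<le> ell2_norm V f"
    using f(1) edge s(1) edge_vertices(1) by (intro L2_set_le_ell2_norm) blast+
  then have "sqrt (real n) \<le> ell2_norm V f"
    by (simp add: L2_set_def sum.reindex[OF inj_on_subset[OF inj']] one)
  then have "real n \<le> (ell2_norm V f)\<^sup>2" by (rule sqrt_le_D)
  with n show False by simp
qed

text \<open>The range is cut out by closed conditions: at each vertex \<open>g\<close> is a fixed
  multiple of its value at the pivot of the parent, or 0. A uniform lower bound on the pivot weights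
  makes the evident preimage of such a \<open>g\<close> square summable.\<close>

lemma closed_range:
  assumes c: "0 < shift_c V E lam" and fin: "finite free_vertices"
  shows "closedin (ell2_topology V) (Range S)"
proof -
  obtain d0 where d0: "d0 > 0" "\<And>v. v \<in> non_roots V E \<Longrightarrow> lam v \<noteq> 0 \<Longrightarrow>
      ecard (children V E (par E v)) = 1 \<Longrightarrow> d0 \<le> cmod (lam v)"
    using c unfolding shift_c_pos_iff by blast
  \<comment> \<open>\<open>d0\<close> handles vertices of \<open>Vp\<close> with one child; the
    remaining ones are branching, hence finitely many, and a minimum suffices.\<close>
  let ?M = "insert d0 ((\<lambda>u. cmod (lam (pivot u))) ` (branching V E \<inter> Vp))"
  define d where "d = Min ?M"
  have finM: "finite ?M"
    using fin by (simp add: finite_free_vertices_iff)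
  have d: "d > 0"
    unfolding d_def using finM d0(1) pivot(2) by (subst Min_gr_iff) auto
  have lower: "d \<le> cmod (lam (pivot u))" if u: "u \<in> Vp" for u
  proof (cases "u \<in> branching V E")
    case True
    with u finM show ?thesis unfolding d_def by (intro Min_le) auto
  next
    case False
    then have "children V E u = {pivot u}"
      using non_branching_child_unique pivot(1)[OF u] by (auto simp: mem_children)
    then have "ecard (children V E u) = 1" by (simp add: ecard_def one_enat_def)
    with pivot[OF u] have "d0 \<le> cmod (lam (pivot u))"
      using par_eq by (intro d0(2)) (auto simp: mem_non_roots)
    moreover have "d \<le> d0" using finM by (auto simp: d_def)
    ultimately show ?thesis by simp
  qed
  \<comment> \<open>The value 0 encodes the condition \<open>g v = 0\<close> at the root and below
    vertices outside \<open>Vp\<close>.\<close>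
  define a where "a v = (if v \<in> non_roots V E \<and> par E v \<in> Vp
      then lam v / lam (pivot (par E v)) else 0)" for v
  let ?C = "\<lambda>v. {g \<in> topspace (ell2_topology V). g v = a v * g (pivot (par E v))}"
  have "closedin (ell2_topology V) (?C v)" for v
  proof (intro closedin_continuous_maps_eq[of euclidean] continuous_map_ell2_apply)
    have "continuous_map euclidean euclidean (\<lambda>z. a v * z)" by (auto intro!: continuous_intros)
    from continuous_map_compose[OF continuous_map_ell2_apply this]
    show "continuous_map (ell2_topology V) euclidean (\<lambda>g. a v * g (pivot (par E v)))"
      by (simp add: o_def)
  qed simp
  then have "closedin (ell2_topology V) (\<Inter>v. ?C v)" by (intro closedin_INT) auto
  moreover have "(\<Inter>v. ?C v) = Range S"
  proof (intro equalityI subsetI)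
    fix g assume "g \<in> Range S"
    then obtain f where f: "g \<in> ell2 V" "g = L f" by (auto simp: mem_shift)
    have "g v = a v * g (pivot (par E v))" for v
    proof (cases "\<exists>u. (u, v) \<in> E")
      case True
      then obtain u where u: "(u, v) \<in> E" by blast
      show ?thesis
      proof (cases "u \<in> Vp")
        case True
        with u f(2) pivot[OF True] show ?thesis
          by (auto simp: a_def par_eq mem_non_roots shift_map_edge)
      next
        case False
        with u f(2) show ?thesis by (auto simp: a_def par_eq shift_map_edge mem_V_plus)
      qed
    qed (use f(2) in \<open>simp add: a_def mem_non_roots shift_map_no_parent\<close>)
    moreover have "g \<in> topspace (ell2_topology V)" using f(1) by simp
    ultimately show "g \<in> (\<Inter>v. ?C v)" by blast
  next
    fix g assume "g \<in> (\<Inter>v. ?C v)"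
    then have "g \<in> topspace (ell2_topology V)" and g2: "\<And>v. g v = a v * g (pivot (par E v))"
      by blast+
    then have g1: "g \<in> ell2 V" by (simp only: topspace_ell2)
    define f where "f u = (if u \<in> Vp then g (pivot u) / lam (pivot u) else 0)" for u
    have Lf: "L f = g"
    proof
      fix v
      show "L f v = g v"
      proof (cases "\<exists>u. (u, v) \<in> E")
        case True
        then obtain u where u: "(u, v) \<in> E" by blast
        then show ?thesis
          using g2[of v] by (auto simp: shift_map_edge f_def a_def par_eq mem_non_roots)
      next
        case False
        then show ?thesis
          using g2[of v] by (simp add: shift_map_no_parent a_def mem_non_roots)
      qed
    qed
    have VpV: "Vp \<subseteq> V" by (auto simp: V_plus_def)
    \<comment> \<open>The values of \<open>g\<close> at pivots, moved to the parents. As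
      \<open>pivot\<close> is injective on \<open>Vp\<close>, this stays square summable, and it
      dominates \<open>f\<close> up to the factor \<open>inverse d\<close>.\<close>
    define g' where "g' u = (if u \<in> Vp then g (pivot u) else 0)" for u
    have "inj_on pivot Vp"
      using pivot(1) parent_unique by (metis inj_onI)
    moreover have "(\<lambda>v. (cmod (g v))\<^sup>2) summable_on pivot ` Vp"
      by (rule summable_on_subset_banach[of _ V])
        (use g1 pivot(1) edge_vertices(2) in \<open>auto simp: ell2_def\<close>)
    ultimately have "(\<lambda>u. (cmod (g (pivot u)))\<^sup>2) summable_on Vp"
      by (simp add: summable_on_reindex o_def)
    also have "?this \<longleftrightarrow> (\<lambda>u. (cmod (g' u))\<^sup>2) summable_on V"
      using VpV by (intro summable_on_cong_neutral) (auto simp: g'_def)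
    finally have "g' \<in> ell2 V" using VpV by (auto simp: ell2_def g'_def)
    moreover have "cmod (f u) \<le> inverse d * cmod (g' u)" for u
    proof (cases "u \<in> Vp")
      case True
      have "cmod (g (pivot u)) / cmod (lam (pivot u)) \<le> cmod (g (pivot u)) / d"
        using lower[OF True] d by (intro frac_le) auto
      with True show ?thesis by (simp add: f_def g'_def norm_divide field_simps)
    qed (simp add: f_def g'_def)
    moreover have "f v = 0" if "v \<notin> V" for v
      using that VpV by (auto simp: f_def)
    ultimately have "f \<in> ell2 V" by (intro ell2_dominated[of g' V f "inverse d"])
    then have "(f, g) \<in> S" using g1 Lf by (simp add: mem_shift)
    then show "g \<in> Range S" by blast
  qed
  ultimately show ?thesis by simp
qed

section \<open>Fredholm criterion and index\<close>

text \<open>A finite dimensional kernel of the adjoint already forces a finite dimensional kernel of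
  the shift, by finiteness of the leaves; it also lets positivity of \<open>shift_c\<close>
  characterize closed range.\<close>

lemma fredholm_iff: "fredholm V S \<longleftrightarrow> 0 < shift_c V E lam \<and> finite free_vertices"
  using closed_range_imp_shift_c_pos closed_range finite_not_V_plus
  by (auto simp: fredholm_def closed_operator_shift dense null_space_shift_dim(1)
      null_space_adjoint_dim(1))

lemma shift_b_finite_iff: "shift_b V E lam < \<infinity> \<longleftrightarrow> finite free_vertices"
  unfolding ecard_less_infinity[symmetric] ecard_free_vertices
  by (cases "shift_b V E lam") (simp_all add: one_enat_def zero_enat_def)

lemma shift_a_finite: "finite free_vertices \<Longrightarrow> shift_a V E lam < \<infinity>"
  unfolding shift_a_def ecard_less_infinity by (rule finite_not_V_plus)

text \<open>Both counts are finite here, so \<open>the_enat\<close> loses nothing. The root, when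
  present, is the one free vertex not counted by \<open>shift_b\<close>.\<close>

lemma index_eq:
  assumes "finite free_vertices"
  shows "fredholm_index V S =
    int (the_enat (shift_a V E lam)) - int (the_enat (shift_b V E lam)) - (if has_root V E then 1 else 0)"
proof -
  obtain b where b: "shift_b V E lam = enat b"
    using assms shift_b_finite_iff by (cases "shift_b V E lam") auto
  have "enat (card free_vertices) = enat (b + (if has_root V E then 1 else 0))"
    using ecard_free_vertices assms b by (auto simp: ecard_def one_enat_def zero_enat_def)
  then have "card free_vertices = b + (if has_root V E then 1 else 0)" by simp
  then show ?thesis
    using finite_not_V_plus[OF assms] assms b
    by (simp add: fredholm_index_def null_space_shift_dim(2) null_space_adjoint_dim(2)
        shift_a_def ecard_def)
qed

end

theorem proposition3p6p2:
  fixes V :: "'a set" and E :: "('a \<times> 'a) set" and lam :: "'a \<Rightarrow> complex"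
  assumes "directed_tree V E"
    and "densely_defined V (weighted_shift V E lam)"
  shows "(fredholm V (weighted_shift V E lam) \<longleftrightarrow>
            0 < shift_c V E lam \<and> shift_b V E lam < \<infinity>) \<and>
         (fredholm V (weighted_shift V E lam) \<longleftrightarrow>
            0 < shift_c V E lam \<and>
            (\<forall>u\<in>V. ecard (children V E u) < \<infinity>) \<and>
            ecard (branching V E) < \<infinity> \<and>
            ecard (non_leaves V E - V_plus V E lam) < \<infinity>) \<and>
         (fredholm V (weighted_shift V E lam) \<longrightarrow>
            shift_a V E lam < \<infinity> \<and>
            fredholm_index V (weighted_shift V E lam) =
              (if has_root V E
               then int (the_enat (shift_a V E lam)) - int (the_enat (shift_b V E lam)) - 1
               else int (the_enat (shift_a V E lam)) - int (the_enat (shift_b V E lam))))"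
proof -
  interpret dense_weighted_shift V E lam
    using assms by (simp add: dense_weighted_shift_def dense_weighted_shift_axioms_def)
  show ?thesis
    unfolding fredholm_iff shift_b_finite_iff ecard_less_infinity
    using finite_free_vertices_iff shift_a_finite index_eq by auto
qed

end
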